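(* For each fixed $s$, $$\lim_{\max\{p,\,n',\,\sum_{i=1}^{s}b_i\}\to\infty,\ {\boldsymbol b}\ne{\boldsymbol 0}}\ \sup_{m}\,f(p,s,m,n',{\boldsymbol b})=0,$$ and for each fixed $m$, $$\lim_{\max\{p,\,n',\,\sum_{i=1}^{s}b_i\}\to\infty,\ {\boldsymbol b}\ne{\boldsymbol 0}}\ f(p,s,m,n',{\boldsymbol b})=0.$$
   Context: $p$ ranges over primes, $s,m$ over positive integers, $n'$ over nonnegative integers, and ${\boldsymbol b}=(b_1,\dots,b_s)$ over integer vectors with $m=b_0\ge b_1\ge\cdots\ge b_s\ge0$. $[p,0]=1$ and $[p,\ell]=\prod_{j=1}^{\ell}(1-p^{-j})$ for $\ell\ge1$. With $b_0=m$, $$f(p,s,m,n',{\boldsymbol b})=p^{-\sum_{i=1}^{s}(n'+b_i)b_i}\cdot\frac{[p,n'+m][p,m]}{[p,n'+b_s][p,b_s]\prod_{i=1}^{s}[p,b_{i-1}-b_i]}.$$ The first limit (with $s$ fixed) means: for every $\varepsilon>0$ there is $N$ such that $\sup_{m\ge b_1}f(p,s,m,n',{\boldsymbol b})<\varepsilon$ whenever ${\boldsymbol b}\ne{\boldsymbol 0}$ and $\max\{p,n',\sum_ib_i\}\ge N$. The second limit (with $m$ fixed) is understood likewise, with $p,s,n',{\boldsymbol b}$ varying. *)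

theory Defs
  imports "HOL-Library.Extended_Real" "HOL-Computational_Algebra.Primes"
begin

definition pbracket :: "nat \<Rightarrow> nat \<Rightarrow> real" where
  "pbracket p l = (\<Prod>j=1..l. 1 - real p powi (- int j))"

text \<open>
  A vector \<open>(b\<^sub>1, \<dots>, b\<^sub>s)\<close> of nonnegative integers is given by a function on \<open>nat\<close>
  of which only the values at \<open>1, \<dots>, s\<close> matter; the convention \<open>b\<^sub>0 = m\<close> is
  enforced by the update \<open>b(0 := m)\<close>. The natural-number differences
  \<open>b\<^sub>i\<^sub>-\<^sub>1 - b\<^sub>i\<close> are the integer ones whenever \<open>m \<ge> b\<^sub>1 \<ge> \<dots> \<ge> b\<^sub>s\<close>.
\<close>

definition fval :: "nat \<Rightarrow> nat \<Rightarrow> nat \<Rightarrow> nat \<Rightarrow> (nat \<Rightarrow> nat) \<Rightarrow> real" where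
  "fval p s m n' b =
     real p powi (- int (\<Sum>i=1..s. (n' + b i) * b i)) *
     (pbracket p (n' + m) * pbracket p m /
       (pbracket p (n' + b s) * pbracket p (b s) *
        (\<Prod>i=1..s. pbracket p ((b(0 := m)) (i - 1) - b i))))"

end

theory Submission
  imports Defs
begin

text \<open>
  Both limits follow from the single estimate \<open>fval p s m n' b \<le> 16 / (D * M)\<close>, where
  \<open>M = max {p, n', \<Sum>b\<^sub>i}\<close> and \<open>D = \<Prod>i=1..s. [p, b\<^sub>i\<^sub>-\<^sub>1 - b\<^sub>i]\<close>, combined with a lower bound
  on \<open>D\<close> by a positive constant that depends only on the parameter held fixed.

  The estimate has two sources. First, all brackets lie in \<open>[1/4, 1]\<close>
  (\<open>pbracket_ge_quarter\<close>, \<open>pbracket_le_one\<close>), so the bracket part of \<open>fval\<close> is at most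
  \<open>16 / D\<close>. Secondly, for \<open>b \<noteq> 0\<close> the exponent \<open>E = \<Sum>(n' + b\<^sub>i) b\<^sub>i\<close> is at least each of
  \<open>1\<close>, \<open>n'\<close> and \<open>\<Sum>b\<^sub>i\<close>; since \<open>E < p ^ E\<close>, this gives \<open>M \<le> p ^ E\<close> (\<open>max_le_power\<close>).

  When \<open>s\<close> is fixed, \<open>D \<ge> (1/4) ^ s\<close> because there are \<open>s\<close> factors, and \<open>m\<close> does not enter.
  When \<open>m\<close> is fixed, the number of factors is unbounded, but \<open>[p, d] \<ge> (1/2) ^ d\<close>
  (\<open>pbracket_ge_power\<close>) and the differences \<open>b\<^sub>i\<^sub>-\<^sub>1 - b\<^sub>i\<close> telescope to \<open>m - b\<^sub>s\<close>,
  so \<open>D \<ge> (1/2) ^ m\<close>.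
\<close>

section \<open>Bounds on the brackets\<close>

lemma pbracket_0 [simp]: "pbracket p 0 = 1"
  by (simp add: pbracket_def)

lemma pbracket_Suc: "pbracket p (Suc l) = pbracket p l * (1 - 1 / real p ^ Suc l)"
  by (simp add: pbracket_def power_int_minus field_simps del: power_Suc of_nat_Suc)

lemma inverse_power_le:
  assumes "2 \<le> p"
  shows "1 / real p ^ l \<le> (1/2) ^ l"
proof -
  have "(2::real) ^ l \<le> real p ^ l"
    using assms by (intro power_mono) auto
  then show ?thesis
    using assms by (simp add: power_one_over frac_le)
qed

lemma factor_ge_half:
  assumes "2 \<le> p"
  shows "1/2 \<le> 1 - 1 / real p ^ Suc l"
proof -
  have "(1/2::real) ^ l \<le> 1"
    by (simp add: power_le_one)
  then show ?thesis
    using inverse_power_le[OF assms, of "Suc l"] by simp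
qed

lemma pbracket_ge_power:
  assumes "2 \<le> p"
  shows "(1/2) ^ l \<le> pbracket p l"
proof (induction l)
  case (Suc l)
  have "(1/2) ^ l * (1/2) \<le> pbracket p l * (1 - 1 / real p ^ Suc l)"
    using Suc factor_ge_half[OF assms, of l]
    by (intro mult_mono) (auto intro: order_trans[OF zero_le_power Suc])
  then show ?case
    by (simp add: pbracket_Suc mult.commute)
qed simp

lemma pbracket_pos:
  assumes "2 \<le> p"
  shows "0 < pbracket p l"
proof -
  have "(0::real) < (1/2) ^ l" by simp
  then show ?thesis using pbracket_ge_power[OF assms, of l] by linarith
qed

lemma pbracket_le_one:
  assumes "2 \<le> p"
  shows "pbracket p l \<le> 1"
proof (induction l)
  case (Suc l)
  have "pbracket p l * (1 - 1 / real p ^ Suc l) \<le> 1 * 1"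
    using Suc factor_ge_half[OF assms, of l] by (intro mult_mono) auto
  then show ?case
    by (simp add: pbracket_Suc)
qed simp

text \<open>
  A bound by \<open>1/4\<close> alone is not inductive, whereas the slack \<open>x = (1/2) ^ (l + 1)\<close>
  absorbs the next factor: \<open>(1/4 + x) (1 - x) \<ge> 1/4 + x/2\<close> as soon as \<open>x \<le> 1/4\<close>, that is,
  for \<open>l \<ge> 1\<close>. Hence the shift of \<open>l\<close>.
\<close>

lemma pbracket_Suc_ge:
  assumes "2 \<le> p"
  shows "1/4 + (1/2) ^ (l + 2) \<le> pbracket p (Suc l)"
proof (induction l)
  case 0
  then show ?case
    using factor_ge_half[OF assms, of 0] by (simp add: pbracket_Suc power2_eq_square)
next
  case (Suc l)
  define x :: real where "x = (1/2) ^ (l + 2)"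
  have x: "0 < x" "x \<le> 1/4"
    by (auto simp: x_def power_add power2_eq_square power_le_one)
  have "1 - x \<le> 1 - 1 / real p ^ Suc (Suc l)"
    using inverse_power_le[OF assms, of "l + 2"] by (simp add: x_def)
  then have "(1/4 + x) * (1 - x) \<le> pbracket p (Suc l) * (1 - 1 / real p ^ Suc (Suc l))"
    using Suc x pbracket_pos[OF assms, of "Suc l"]
    by (intro mult_mono) (auto simp: x_def)
  moreover have "1/4 + x/2 \<le> (1/4 + x) * (1 - x)"
  proof -
    have "(1/4 + x) * (1 - x) = 1/4 + x/2 + x * (1/4 - x)"
      by (simp add: field_simps)
    moreover have "0 \<le> x * (1/4 - x)"
      using x by (intro mult_nonneg_nonneg) auto
    ultimately show ?thesis by linarith
  qed
  ultimately show ?case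
    by (simp add: pbracket_Suc[of p "Suc l"] x_def)
qed

lemma pbracket_ge_quarter:
  assumes "2 \<le> p"
  shows "1/4 \<le> pbracket p l"
proof (cases l)
  case (Suc k)
  have "(0::real) \<le> (1/2) ^ (k + 2)" by simp
  then show ?thesis
    using pbracket_Suc_ge[OF assms, of k] unfolding Suc by linarith
qed simp

section \<open>The power of p dominates the maximum\<close>

lemma max_le_power:
  fixes b :: "nat \<Rightarrow> nat"
  assumes p: "2 \<le> p" and nz: "\<exists>i\<in>{1..s}. b i \<noteq> 0"
  shows "Max {p, n', \<Sum>i=1..s. b i} \<le> p ^ (\<Sum>i=1..s. (n' + b i) * b i)"
proof -
  define E where "E = (\<Sum>i=1..s. (n' + b i) * b i)"
  obtain k where k: "k \<in> {1..s}" "1 \<le> b k"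
    using nz by force
  have k_le: "(n' + b k) * b k \<le> E"
    unfolding E_def using k(1) by (intro member_le_sum) auto
  have "(n' + b k) * 1 \<le> (n' + b k) * b k"
    using k(2) by (intro mult_le_mono) auto
  then have "n' + b k \<le> E"
    using order_trans[OF _ k_le] by simp
  then have "n' \<le> E" "1 \<le> E"
    using k(2) by linarith+
  moreover have "(\<Sum>i=1..s. b i) \<le> E"
    unfolding E_def by (intro sum_mono) (auto simp: add_mult_distrib intro: trans_le_add2)
  moreover have "E \<le> p ^ E"
    using p by (intro less_imp_le power_gt_expt) auto
  moreover have "p \<le> p ^ E"
    using p \<open>1 \<le> E\<close> by (intro self_le_power) auto
  ultimately show ?thesis
    by (simp add: E_def)
qed

section \<open>The common estimate\<close>

lemma fval_le:
  fixes b :: "nat \<Rightarrow> nat"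
  assumes p: "2 \<le> p" and nz: "\<exists>i\<in>{1..s}. b i \<noteq> 0"
    and N: "0 < N" "N \<le> Max {p, n', \<Sum>i=1..s. b i}"
    and Q: "0 < Q" "Q \<le> (\<Prod>i=1..s. pbracket p ((b(0 := m)) (i - 1) - b i))"
  shows "fval p s m n' b \<le> 16 / Q / real N"
proof -
  let ?E = "\<Sum>i=1..s. (n' + b i) * b i"
  let ?D = "\<Prod>i=1..s. pbracket p ((b(0 := m)) (i - 1) - b i)"
  have "real N \<le> real p ^ ?E"
    using order_trans[OF N(2) max_le_power[OF p nz]] by (metis of_nat_le_iff of_nat_power)
  then have pow: "real p powi (- int ?E) \<le> 1 / real N"
    using N(1) p by (simp add: power_int_minus inverse_eq_divide frac_le del: of_nat_sum)
  have num: "pbracket p (n' + m) * pbracket p m \<le> 1 * 1"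
    using pbracket_le_one[OF p] pbracket_pos[OF p] by (intro mult_mono) (auto intro: less_imp_le)
  have "(1/4) * (1/4) * Q \<le> pbracket p (n' + b s) * pbracket p (b s) * ?D"
    using pbracket_ge_quarter[OF p] pbracket_pos[OF p] Q
    by (intro mult_mono) (auto intro: less_imp_le)
  then have frac: "pbracket p (n' + m) * pbracket p m
      / (pbracket p (n' + b s) * pbracket p (b s) * ?D) \<le> 1 / (Q / 16)"
    using num Q(1) by (intro frac_le) auto
  have "fval p s m n' b \<le> 1 / real N * (1 / (Q / 16))"
    unfolding fval_def
  proof (intro mult_mono pow frac)
    show "0 \<le> pbracket p (n' + m) * pbracket p m
        / (pbracket p (n' + b s) * pbracket p (b s) * ?D)"
      using pbracket_pos[OF p]
      by (intro divide_nonneg_nonneg mult_nonneg_nonneg prod_nonneg) (auto intro: less_imp_le)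
  qed auto
  then show ?thesis
    by (simp add: field_simps)
qed

section \<open>Lower bounds on the product of the brackets of differences\<close>

lemma prod_pbracket_ge_length:
  assumes "2 \<le> p"
  shows "(1/4) ^ s \<le> (\<Prod>i=1..s. pbracket p (d i))"
proof -
  have "(\<Prod>i=1..s. 1/4) \<le> (\<Prod>i=1..s. pbracket p (d i))"
    using pbracket_ge_quarter[OF assms] by (intro prod_mono) auto
  then show ?thesis by simp
qed

lemma prod_pbracket_ge_sum:
  assumes "2 \<le> p"
  shows "(1/2) ^ (\<Sum>i=1..s. d i) \<le> (\<Prod>i=1..s. pbracket p (d i))"
proof -
  have "(\<Prod>i=1..s. (1/2) ^ d i) \<le> (\<Prod>i=1..s. pbracket p (d i))"
    using pbracket_ge_power[OF assms] by (intro prod_mono) auto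
  then show ?thesis by (simp add: power_sum)
qed

lemma sum_differences_antimono:
  fixes c :: "nat \<Rightarrow> nat"
  assumes "antimono_on {0..s} c"
  shows "(\<Sum>i=1..s. c (i - 1) - c i) = c 0 - c s"
  using assms
proof (induction s)
  case (Suc s)
  have "antimono_on {0..s} c"
    using Suc.prems by (rule monotone_on_subset) auto
  moreover have "c (Suc s) \<le> c s" "c s \<le> c 0"
    by (auto intro: monotone_onD[OF Suc.prems])
  ultimately show ?case
    using Suc.IH by simp
qed simp

lemma antimono_on_update_0:
  fixes b :: "nat \<Rightarrow> nat"
  assumes "antimono_on {1..s} b" and "b 1 \<le> m"
  shows "antimono_on {0..s} (b(0 := m))"
proof (rule monotone_onI)
  fix i j assume ij: "i \<in> {0..s}" "j \<in> {0..s}" "i \<le> j"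
  show "(b(0 := m)) j \<le> (b(0 := m)) i"
  proof (cases "i = 0")
    case True
    have "b j \<le> b 1" if "j \<noteq> 0"
      using that ij by (intro monotone_onD[OF assms(1)]) auto
    with True assms(2) show ?thesis by auto
  next
    case False
    with ij show ?thesis using monotone_onD[OF assms(1), of i j] by auto
  qed
qed

lemma prod_pbracket_differences_ge:
  fixes b :: "nat \<Rightarrow> nat"
  assumes p: "2 \<le> p" and b: "antimono_on {1..s} b" "b 1 \<le> m"
  shows "(1/2) ^ m \<le> (\<Prod>i=1..s. pbracket p ((b(0 := m)) (i - 1) - b i))"
proof -
  let ?c = "b(0 := m)"
  have "(\<Sum>i=1..s. ?c (i - 1) - b i) = (\<Sum>i=1..s. ?c (i - 1) - ?c i)"
    by (intro sum.cong) auto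
  also have "\<dots> = m - ?c s"
    using sum_differences_antimono[OF antimono_on_update_0[OF b]] by simp
  finally have "(\<Sum>i=1..s. ?c (i - 1) - b i) \<le> m"
    by linarith
  then have "(1/2::real) ^ m \<le> (1/2) ^ (\<Sum>i=1..s. ?c (i - 1) - b i)"
    by (intro power_decreasing) auto
  then show ?thesis
    using prod_pbracket_ge_sum[OF p] by (rule order_trans)
qed

section \<open>The limits\<close>

lemma ex_nat_divide_less:
  fixes C e :: real
  assumes "0 < e"
  shows "\<exists>N::nat. 0 < N \<and> C / real N < e"
proof -
  obtain N :: nat where N: "max 0 (C / e) < real N"
    using reals_Archimedean2 by blast
  then have "0 < N" by auto
  with N assms show ?thesis
    by (intro exI[of _ N]) (auto simp: field_simps)
qed

theorem theorem5p7:
  shows "(\<forall>s::nat. 1 \<le> s \<longrightarrow>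
      (\<forall>\<epsilon>::real. 0 < \<epsilon> \<longrightarrow> (\<exists>N::nat. \<forall>(p::nat) (n'::nat) (b::nat \<Rightarrow> nat).
        prime p \<and> antimono_on {1..s} b \<and> (\<exists>i\<in>{1..s}. b i \<noteq> 0) \<and>
        N \<le> Max {p, n', \<Sum>i=1..s. b i} \<longrightarrow>
        (SUP m\<in>{b 1..}. ereal (fval p s m n' b)) < ereal \<epsilon>))) \<and>
      (\<forall>m::nat. 1 \<le> m \<longrightarrow>
      (\<forall>\<epsilon>::real. 0 < \<epsilon> \<longrightarrow> (\<exists>N::nat. \<forall>(p::nat) (s::nat) (n'::nat) (b::nat \<Rightarrow> nat).
        prime p \<and> 1 \<le> s \<and> antimono_on {1..s} b \<and> b 1 \<le> m \<and> (\<exists>i\<in>{1..s}. b i \<noteq> 0) \<and>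
        N \<le> Max {p, n', \<Sum>i=1..s. b i} \<longrightarrow>
        fval p s m n' b < \<epsilon>)))"
proof (intro conjI allI impI)
  fix s :: nat and e :: real
  assume "1 \<le> s" and e: "0 < e"
  \<comment> \<open>The supremum of values below a bound may attain it, so \<open>e/2\<close> is used to get strictness.\<close>
  obtain N :: nat where N: "0 < N" "16 / (1/4) ^ s / real N < e / 2"
    using ex_nat_divide_less[of "e / 2" "16 / (1/4) ^ s"] e by auto
  show "\<exists>N::nat. \<forall>(p::nat) (n'::nat) (b::nat \<Rightarrow> nat).
        prime p \<and> antimono_on {1..s} b \<and> (\<exists>i\<in>{1..s}. b i \<noteq> 0) \<and>
        N \<le> Max {p, n', \<Sum>i=1..s. b i} \<longrightarrow>
        (SUP m\<in>{b 1..}. ereal (fval p s m n' b)) < ereal e"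
  proof (intro exI[of _ N] allI impI, elim conjE)
    fix p n' :: nat and b :: "nat \<Rightarrow> nat"
    assume p: "prime p" and nz: "\<exists>i\<in>{1..s}. b i \<noteq> 0"
      and M: "N \<le> Max {p, n', \<Sum>i=1..s. b i}"
    have p2: "2 \<le> p"
      using p by (rule prime_ge_2_nat)
    have "fval p s m n' b \<le> e / 2" for m
      using fval_le[OF p2 nz N(1) M _ prod_pbracket_ge_length[OF p2], of m] N(2) by simp
    then have "(SUP m\<in>{b 1..}. ereal (fval p s m n' b)) \<le> ereal (e / 2)"
      by (intro SUP_least) simp
    also have "\<dots> < ereal e"
      using e by simp
    finally show "(SUP m\<in>{b 1..}. ereal (fval p s m n' b)) < ereal e" .
  qed
next
  fix m :: nat and e :: real
  assume "1 \<le> m" and e: "0 < e"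
  obtain N :: nat where N: "0 < N" "16 / (1/2) ^ m / real N < e"
    using ex_nat_divide_less[OF e] by blast
  show "\<exists>N::nat. \<forall>(p::nat) (s::nat) (n'::nat) (b::nat \<Rightarrow> nat).
        prime p \<and> 1 \<le> s \<and> antimono_on {1..s} b \<and> b 1 \<le> m \<and> (\<exists>i\<in>{1..s}. b i \<noteq> 0) \<and>
        N \<le> Max {p, n', \<Sum>i=1..s. b i} \<longrightarrow>
        fval p s m n' b < e"
  proof (intro exI[of _ N] allI impI, elim conjE)
    fix p s n' :: nat and b :: "nat \<Rightarrow> nat"
    assume p: "prime p" and b: "antimono_on {1..s} b" "b 1 \<le> m"
      and nz: "\<exists>i\<in>{1..s}. b i \<noteq> 0"
      and M: "N \<le> Max {p, n', \<Sum>i=1..s. b i}"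
    have p2: "2 \<le> p"
      using p by (rule prime_ge_2_nat)
    show "fval p s m n' b < e"
      using fval_le[OF p2 nz N(1) M _ prod_pbracket_differences_ge[OF p2 b]] N(2) by simp
  qed
qed

end
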